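(* For any parity constraints over input variables $X=\{x_1,\dots,x_n\}$ and any linear encodings $a=\mathsf{Parity}(A,S,\sigma_a)$ and $b=\mathsf{Parity}(B,T,\sigma_b)$ of them (any $A,B\subseteq X$ and any orderings $\sigma_a,\sigma_b$ for which the formula below is defined), the formula $\mathsf{rAddPar}(a,b)$ has an Extended Resolution refutation with $O(n\log n)$ lines.
   Context: For literals $y_1,\dots,y_k$, $\mathsf{xor}(y_1,\dots,y_k)$ is the CNF of all $2^{k-1}$ clauses on exactly these literals with an odd (if $k$ odd) or even (if $k$ even) number of unnegated $y_j$'s; it encodes $y_1\oplus\dots\oplus y_k=0$. For a list of $m\ge4$ literals $(y_1,\dots,y_m)$ with fresh variables $t_1,\dots,t_{m-3}$, its linear encoding is $\mathsf{xor}(y_1,y_2,t_1)\wedge\bigwedge_{j=1}^{m-4}\mathsf{xor}(t_j,y_{j+2},t_{j+1})\wedge\mathsf{xor}(t_{m-3},y_{m-1},y_m)$. $a=\mathsf{Parity}(A,S,\sigma_a)$ is the linear encoding of $A$ listed in order $\sigma_a$ with Tseitin variables $S$; $b$ likewise for $B,\sigma_b,T$. $C$ is $A\triangle B$ with one literal negated, listed in increasing index order, and $\mathsf{rAddPar}(a,b)=a\wedge b\wedge\mathsf{Parity}(C,U,\mathrm{id})$ with $S,T,U,X$ pairwise disjoint. Extended Resolution is resolution (derive $C_1\vee C_2$ from $C_1\vee x$ and $C_2\vee\bar x$) together with the extension rule, which introduces a new variable $p$ not occurring so far together with clauses defining $p$ as a function of existing literals (e.g. the clauses of $p\leftrightarrow(x\oplus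 y)$); a refutation derives the empty clause, and lines are its derived/introduced clauses. *)

theory Defs
  imports Complex_Main "HOL-Library.Landau_Symbols"
begin

type_synonym var = nat

datatype lit = Pos var | Neg var

type_synonym clause = "lit set"
type_synonym cnf = "clause set"

fun var_of :: "lit \<Rightarrow> var" where
  "var_of (Pos v) = v"
| "var_of (Neg v) = v"

fun negate :: "lit \<Rightarrow> lit" where
  "negate (Pos v) = Neg v"
| "negate (Neg v) = Pos v"

definition vars :: "cnf \<Rightarrow> var set" where
  "vars F = var_of ` (\<Union>F)"

fun lit_true :: "(var \<Rightarrow> bool) \<Rightarrow> lit \<Rightarrow> bool" where
  "lit_true \<alpha> (Pos v) \<longleftrightarrow> \<alpha> v"
| "lit_true \<alpha> (Neg v) \<longleftrightarrow> \<not> \<alpha> v"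

definition satisfies :: "(var \<Rightarrow> bool) \<Rightarrow> cnf \<Rightarrow> bool" where
  "satisfies \<alpha> F \<longleftrightarrow> (\<forall>C\<in>F. \<exists>l\<in>C. lit_true \<alpha> l)"

definition sign_clause :: "lit list \<Rightarrow> nat set \<Rightarrow> clause" where
  "sign_clause ys P = {if j \<in> P then ys ! j else negate (ys ! j) | j. j < length ys}"

text \<open>
  \<open>sign_clause ys P\<close> is falsified exactly when the literals at the positions in \<open>P\<close> are false and
  the remaining ones are true.  Forbidding an odd number of true literals among \<open>k\<close> therefore
  requires \<open>k - card P\<close> to be odd: an even number of unnegated literals if \<open>k\<close> is odd, and an odd
  number if \<open>k\<close> is even.  (The opposite choice encodes \<open>y\<^sub>1 \<oplus> \<dots> \<oplus> y\<^sub>k = 1\<close>; for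
  ternary constraints, the only ones used below, it amounts to negating every variable.)
\<close>

definition xor_cnf :: "lit list \<Rightarrow> cnf" where
  "xor_cnf ys = {sign_clause ys P | P. P \<subseteq> {..<length ys} \<and> (even (card P) \<longleftrightarrow> odd (length ys))}"

lemma lit_true_negate [simp]: "lit_true \<alpha> (negate l) \<longleftrightarrow> \<not> lit_true \<alpha> l"
  by (cases l) auto

lemma satisfies_xor_cnf:
  "satisfies \<alpha> (xor_cnf ys) \<longleftrightarrow> even (card {j. j < length ys \<and> lit_true \<alpha> (ys ! j)})"
proof -
  let ?k = "length ys"
  let ?Q = "{j. j < ?k \<and> \<not> lit_true \<alpha> (ys ! j)}"
  let ?R = "{j. j < ?k \<and> lit_true \<alpha> (ys ! j)}"
  have fals: "\<not> (\<exists>l\<in>sign_clause ys P. lit_true \<alpha> l) \<longleftrightarrow> P = ?Q"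
    if "P \<subseteq> {..<?k}" for P
    using that by (auto simp: sign_clause_def split: if_splits)
  have "?Q \<union> ?R = {..<?k}" "?Q \<inter> ?R = {}" by auto
  then have "card ?Q + card ?R = ?k"
    using card_Un_disjoint [of ?Q ?R] by simp
  moreover have aux: "(even q \<longleftrightarrow> odd k) \<longleftrightarrow> odd r" if "q + r = k" for q r k :: nat
    using that by auto
  ultimately have par: "(even (card ?Q) \<longleftrightarrow> odd ?k) \<longleftrightarrow> odd (card ?R)"
    using aux by blast
  have "\<not> satisfies \<alpha> (xor_cnf ys) \<longleftrightarrow>
      (\<exists>P. P \<subseteq> {..<?k} \<and> (even (card P) \<longleftrightarrow> odd ?k) \<and> \<not> (\<exists>l\<in>sign_clause ys P. lit_true \<alpha> l))"
    unfolding satisfies_def xor_cnf_def by blast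
  also have "\<dots> \<longleftrightarrow> (\<exists>P. P \<subseteq> {..<?k} \<and> (even (card P) \<longleftrightarrow> odd ?k) \<and> P = ?Q)"
    using fals by blast
  also have "\<dots> \<longleftrightarrow> odd (card ?R)"
    using par by auto
  finally show ?thesis by blast
qed

text \<open>
  With \<open>m = length ys\<close>, the literal \<open>y\<^sub>j\<close> is \<open>ys ! (j - 1)\<close> and the Tseitin variable \<open>t\<^sub>j\<close> is
  \<open>ts ! (j - 1)\<close>.  Meaningful only for \<open>m \<ge> 4\<close> and \<open>length ts = m - 3\<close>.
\<close>

definition linear_encoding :: "lit list \<Rightarrow> var list \<Rightarrow> cnf" where
  "linear_encoding ys ts = (let m = length ys; y = (\<lambda>j. ys ! (j - 1)); t = (\<lambda>j. Pos (ts ! (j - 1))) in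
     xor_cnf [y 1, y 2, t 1] \<union>
     (\<Union>j\<in>{1..m - 4}. xor_cnf [t j, y (j + 2), t (j + 1)]) \<union>
     xor_cnf [t (m - 3), y (m - 1), y m])"

text \<open>
  The side conditions under which \<open>linear_encoding (map Pos \<sigma>) S\<close> is the encoding
  \<open>Parity(A, S, \<sigma>)\<close>: the list \<open>\<sigma>\<close> enumerates \<open>A\<close> and \<open>S\<close> lists the Tseitin variables.
\<close>

definition is_parity :: "var set \<Rightarrow> var list \<Rightarrow> var list \<Rightarrow> bool" where
  "is_parity A S \<sigma> \<longleftrightarrow>
     set \<sigma> = A \<and> distinct \<sigma> \<and> length \<sigma> \<ge> 4 \<and> distinct S \<and> length S = length \<sigma> - 3"

text \<open>
  \<open>X\<close> lists the input variables in index order, so that filtering it lists a set of input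
  variables by increasing index; \<open>z\<close> is the variable whose literal is negated.
\<close>

definition sym_diff_list :: "var list \<Rightarrow> var set \<Rightarrow> var set \<Rightarrow> var list" where
  "sym_diff_list X A B = filter (\<lambda>v. v \<in> sym_diff A B) X"

definition rAddPar ::
  "var list \<Rightarrow> var list \<Rightarrow> var list \<Rightarrow> var list \<Rightarrow> var list \<Rightarrow> var list \<Rightarrow> var \<Rightarrow> cnf" where
  "rAddPar X \<sigma>a S \<sigma>b T U z =
     linear_encoding (map Pos \<sigma>a) S \<union>
     linear_encoding (map Pos \<sigma>b) T \<union>
     linear_encoding (map (\<lambda>v. if v = z then Neg v else Pos v)
       (sym_diff_list X (set \<sigma>a) (set \<sigma>b))) U"

definition is_resolvent :: "clause \<Rightarrow> clause \<Rightarrow> clause \<Rightarrow> bool" where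
  "is_resolvent C D E \<longleftrightarrow>
     (\<exists>v. Pos v \<in> C \<and> Neg v \<in> D \<and> E = (C - {Pos v}) \<union> (D - {Neg v}))"

definition defines_as_function :: "var \<Rightarrow> lit list \<Rightarrow> cnf \<Rightarrow> bool" where
  "defines_as_function p ls D \<longleftrightarrow>
     (\<forall>C\<in>D. finite C) \<and> vars D \<subseteq> insert p (var_of ` set ls) \<and>
     (\<exists>g. \<forall>\<alpha>. satisfies \<alpha> D \<longleftrightarrow> (\<alpha> p \<longleftrightarrow> g (map (lit_true \<alpha>) ls)))"

text \<open>
  The list collects the derived and introduced clauses, but not the clauses of \<open>F\<close>; each defining
  clause of an extension variable is a line of its own.
\<close>

inductive ER_derivation :: "cnf \<Rightarrow> clause list \<Rightarrow> bool" for F where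
  Empty: "ER_derivation F []"
| Resolution:
    "\<lbrakk>ER_derivation F \<pi>; C \<in> F \<union> set \<pi>; D \<in> F \<union> set \<pi>; is_resolvent C D E\<rbrakk>
      \<Longrightarrow> ER_derivation F (\<pi> @ [E])"
| Extension:
    "\<lbrakk>ER_derivation F \<pi>; p \<notin> vars (F \<union> set \<pi>); var_of ` set ls \<subseteq> vars (F \<union> set \<pi>);
      defines_as_function p ls (set \<Delta>)\<rbrakk>
      \<Longrightarrow> ER_derivation F (\<pi> @ \<Delta>)"

definition ER_refutation :: "cnf \<Rightarrow> clause list \<Rightarrow> bool" where
  "ER_refutation F \<pi> \<longleftrightarrow> ER_derivation F \<pi> \<and> {} \<in> set \<pi>"

end

theory Submission
  imports Defs
begin

text \<open>
  With a variable \<open>w\<close> defined to be false, each linear encoding is a chain of running parities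
  from \<open>w\<close> to \<open>w\<close>, so the three encodings concatenate to one chain over a list of at most \<open>3 n\<close>
  literals. Splitting the input variables into two halves splits a chain into two, the running parity
  being the exclusive or of the two partial running parities; maintaining this relation costs a
  constant number of lines per literal. After \<open>log n\<close> rounds of splitting every chain is over one
  variable. Each chain's parity is constant, since each variable occurs an even number of times
  in the concatenation; these constants are recombined at constant cost per node of the splitting
  tree, and the overall constant is 1 because of the negated literal, contradicting that the chain
  ends in \<open>w\<close>.
\<close>

section \<open>Bounded derivations\<close>

text \<open>Only the clause set reached and a bound on the number of lines are kept, so that
  derivations compose like a transitive relation.\<close>

definition er_steps :: "cnf \<Rightarrow> nat \<Rightarrow> cnf \<Rightarrow> bool" where
  "er_steps E k E' \<longleftrightarrow> (\<exists>\<pi>. ER_derivation E \<pi> \<and> E' = E \<union> set \<pi> \<and> length \<pi> \<le> k)"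

text \<open>The side conditions of both rules refer only to the set of clauses available so far, and
  this set is the same whether the lines of \<open>\<pi>\<close> count as axioms or as derived
  lines.\<close>

lemma ER_derivation_append:
  assumes "ER_derivation (F \<union> set \<pi>) \<pi>'" and "ER_derivation F \<pi>"
  shows "ER_derivation F (\<pi> @ \<pi>')"
  using assms
proof (induction rule: ER_derivation.induct)
  case Empty
  then show ?case by simp
next
  case (Resolution \<pi>' C D R)
  then have "ER_derivation F ((\<pi> @ \<pi>') @ [R])"
    by (intro ER_derivation.Resolution) (auto simp: Un_assoc)
  then show ?case by simp
next
  case (Extension \<pi>' p ls \<Delta>)
  then have "ER_derivation F ((\<pi> @ \<pi>') @ \<Delta>)"
    by (intro ER_derivation.Extension [where p = p and ls = ls and \<pi> = "\<pi> @ \<pi>'"])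
      (simp_all add: Un_assoc)
  then show ?case by simp
qed

lemma er_steps_refl: "er_steps E 0 E"
  unfolding er_steps_def by (rule exI [of _ "[]"]) (auto intro: ER_derivation.Empty)

lemma er_steps_trans:
  assumes "er_steps E k E'" "er_steps E' l E''"
  shows "er_steps E (k + l) E''"
proof -
  obtain \<pi> where \<pi>: "ER_derivation E \<pi>" "E' = E \<union> set \<pi>" "length \<pi> \<le> k"
    using assms(1) unfolding er_steps_def by blast
  obtain \<pi>' where \<pi>': "ER_derivation E' \<pi>'" "E'' = E' \<union> set \<pi>'" "length \<pi>' \<le> l"
    using assms(2) unfolding er_steps_def by blast
  show ?thesis
    unfolding er_steps_def using \<pi> \<pi>' ER_derivation_append [of E \<pi> \<pi>']
    by (intro exI [of _ "\<pi> @ \<pi>'"]) auto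
qed

lemma er_steps_mono: "er_steps E k E' \<Longrightarrow> k \<le> l \<Longrightarrow> er_steps E l E'"
  unfolding er_steps_def by (elim exE conjE, intro exI conjI) auto

lemma er_steps_subset: "er_steps E k E' \<Longrightarrow> E \<subseteq> E'"
  unfolding er_steps_def by auto

lemma er_steps_resolve:
  "C \<in> E \<Longrightarrow> D \<in> E \<Longrightarrow> is_resolvent C D R \<Longrightarrow> er_steps E 1 (insert R E)"
  unfolding er_steps_def
  using ER_derivation.Resolution [OF ER_derivation.Empty, of C E D R]
  by (intro exI [of _ "[R]"]) auto

lemma er_steps_extend:
  assumes "p \<notin> vars E" "var_of ` set ls \<subseteq> vars E" "defines_as_function p ls D"
    and "finite D" "card D \<le> k"
  shows "er_steps E k (E \<union> D)"
proof -
  obtain \<Delta> where \<Delta>: "set \<Delta> = D" "length \<Delta> = card D"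
    using finite_distinct_list [OF \<open>finite D\<close>] distinct_card by metis
  show ?thesis
    unfolding er_steps_def using \<Delta> assms ER_derivation.Extension [OF ER_derivation.Empty, of p E ls \<Delta>]
    by (intro exI [of _ \<Delta>]) auto
qed

lemma vars_mono: "E \<subseteq> E' \<Longrightarrow> vars E \<subseteq> vars E'"
  unfolding vars_def by auto

lemma vars_Un: "vars (E \<union> D) = vars E \<union> vars D"
  unfolding vars_def by auto

text \<open>A fresh extension variable can be found as long as finitely many variables are in use.
  Resolution adds none, and an extension adds at most \<open>p\<close> and the variables of its
  arguments.\<close>

lemma finite_vars_ER_derivation:
  assumes "ER_derivation F \<pi>" "finite (vars F)"
  shows "finite (vars (F \<union> set \<pi>))"
  using assms
proof (induction rule: ER_derivation.induct)
  case Empty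
  then show ?case by simp
next
  case (Resolution \<pi> C D R)
  then have "vars (F \<union> set (\<pi> @ [R])) \<subseteq> vars (F \<union> set \<pi>)"
    unfolding vars_def is_resolvent_def by auto
  with Resolution show ?case using finite_subset by blast
next
  case (Extension \<pi> p ls \<Delta>)
  then have "vars (set \<Delta>) \<subseteq> insert p (var_of ` set ls)"
    unfolding defines_as_function_def by blast
  then have "vars (F \<union> set (\<pi> @ \<Delta>)) \<subseteq> vars (F \<union> set \<pi>) \<union> insert p (var_of ` set ls)"
    by (auto simp: vars_Un)
  moreover have "finite (vars (F \<union> set \<pi>) \<union> insert p (var_of ` set ls))"
    using Extension by simp
  ultimately show ?case by (rule finite_subset)
qed

lemma er_steps_finite_vars: "er_steps E k E' \<Longrightarrow> finite (vars E) \<Longrightarrow> finite (vars E')"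
  unfolding er_steps_def using finite_vars_ER_derivation by blast

section \<open>Derivability of constraints up to subsumption\<close>

text \<open>
  A constraint \<open>P\<close> on the variables \<open>V\<close> counts as available in \<open>E\<close> once each clause it needs is
  subsumed by a member of \<open>E\<close>; this makes weakening unnecessary and tolerates coinciding variables.
\<close>

definition blocks :: "cnf \<Rightarrow> var set \<Rightarrow> ((var \<Rightarrow> bool) \<Rightarrow> bool) \<Rightarrow> bool" where
  "blocks E V P \<longleftrightarrow>
     (\<forall>\<alpha>. \<not> P \<alpha> \<longrightarrow> (\<exists>C\<in>E. var_of ` C \<subseteq> V \<and> (\<forall>l\<in>C. \<not> lit_true \<alpha> l)))"

lemma blocks_mono: "blocks E V P \<Longrightarrow> E \<subseteq> E' \<Longrightarrow> V \<subseteq> V' \<Longrightarrow> (\<And>\<alpha>. P \<alpha> \<Longrightarrow> P' \<alpha>) \<Longrightarrow> blocks E' V' P'"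
  unfolding blocks_def by (meson subsetD subset_trans)

lemma blocks_conj: "blocks E V P \<Longrightarrow> blocks E V' Q \<Longrightarrow> blocks E (V \<union> V') (\<lambda>\<alpha>. P \<alpha> \<and> Q \<alpha>)"
  unfolding blocks_def by (meson le_supI1 le_supI2)

lemma blocks_satisfies:
  assumes "D \<subseteq> E" "vars D \<subseteq> V" "\<And>\<alpha>. satisfies \<alpha> D \<Longrightarrow> P \<alpha>"
  shows "blocks E V P"
  unfolding blocks_def
proof (intro allI impI)
  fix \<alpha> assume "\<not> P \<alpha>"
  then obtain C where C: "C \<in> D" "\<forall>l\<in>C. \<not> lit_true \<alpha> l"
    using assms(3) unfolding satisfies_def by blast
  then have "var_of ` C \<subseteq> V"
    using assms(2) unfolding vars_def by auto
  then show "\<exists>C\<in>E. var_of ` C \<subseteq> V \<and> (\<forall>l\<in>C. \<not> lit_true \<alpha> l)"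
    using C assms(1) by blast
qed

section \<open>Eliminating variables by resolution\<close>

lemma lit_true_cong: "\<alpha> (var_of l) = \<beta> (var_of l) \<Longrightarrow> lit_true \<alpha> l = lit_true \<beta> l"
  by (cases l) auto

text \<open>Querying the variables of \<open>D\<close> one after another gives a decision tree whose
  leaves carry falsified clauses of \<open>E\<close>. Resolving upwards at its
  \<open>2 ^ card D - 1\<close> inner nodes removes the variables of \<open>D\<close>.\<close>

lemma er_steps_clause:
  assumes "finite D" "D \<inter> U = {}"
    and "\<And>\<beta>. \<forall>v\<in>U. \<beta> v = \<alpha> v \<Longrightarrow>
      \<exists>C\<in>E. var_of ` C \<subseteq> U \<union> D \<and> (\<forall>l\<in>C. \<not> lit_true \<beta> l)"
  shows "\<exists>E'. er_steps E (2 ^ card D - 1) E' \<and>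
    (\<exists>C\<in>E'. var_of ` C \<subseteq> U \<and> (\<forall>l\<in>C. \<not> lit_true \<alpha> l))"
  using assms
proof (induction D arbitrary: U \<alpha> E rule: finite_induct)
  case empty
  then show ?case using er_steps_refl by force
next
  case (insert v D)
  have v: "v \<notin> U" and D: "D \<inter> insert v U = {}"
    using insert by auto
  have ex: "\<exists>C\<in>E. var_of ` C \<subseteq> insert v U \<union> D \<and> (\<forall>l\<in>C. \<not> lit_true \<beta> l)"
    if "\<forall>w\<in>insert v U. \<beta> w = (\<alpha>(v := b)) w" for \<beta> b
  proof -
    have "\<forall>w\<in>U. \<beta> w = \<alpha> w" using that v by (metis fun_upd_other insertCI)
    then show ?thesis using insert.prems(2) [of \<beta>] by simp
  qed
  obtain E1 C1 where E1: "er_steps E (2 ^ card D - 1) E1" "C1 \<in> E1"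
    "var_of ` C1 \<subseteq> insert v U" "\<forall>l\<in>C1. \<not> lit_true (\<alpha>(v := False)) l"
    using insert.IH [OF D ex [where b = False]] by blast
  have ex1: "\<exists>C\<in>E1. var_of ` C \<subseteq> insert v U \<union> D \<and> (\<forall>l\<in>C. \<not> lit_true \<beta> l)"
    if "\<forall>w\<in>insert v U. \<beta> w = (\<alpha>(v := True)) w" for \<beta>
    using ex [OF that] er_steps_subset [OF E1(1)] by blast
  obtain E2 C2 where E2: "er_steps E1 (2 ^ card D - 1) E2" "C2 \<in> E2"
    "var_of ` C2 \<subseteq> insert v U" "\<forall>l\<in>C2. \<not> lit_true (\<alpha>(v := True)) l"
    using insert.IH [OF D ex1] by blast
  have E12: "er_steps E (2 ^ card D - 1 + (2 ^ card D - 1)) E2"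
    by (rule er_steps_trans [OF E1(1) E2(1)])
  have card: "2 ^ card (insert v D) - 1 = (2 ^ card D - 1 + (2 ^ card D - 1) + 1 :: nat)"
  proof -
    have "(1 :: nat) \<le> 2 ^ card D" by simp
    then show ?thesis using insert.hyps unfolding card_insert_disjoint [OF insert.hyps] power_Suc by linarith
  qed
  have restrict: "var_of l \<in> U \<and> \<not> lit_true \<alpha> l"
    if "l \<in> C" "var_of ` C \<subseteq> insert v U" "\<forall>l\<in>C. \<not> lit_true (\<alpha>(v := b)) l" "var_of l \<noteq> v" for l C b
    using that lit_true_cong [of \<alpha> l "\<alpha>(v := b)"] by auto
  \<comment> \<open>A literal on \<open>v\<close> that is false when \<open>v\<close> is false can
    only be \<open>Pos v\<close>, and dually for \<open>C2\<close>; hence \<open>?R\<close> is free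
    of \<open>v\<close>.\<close>
  have C1: "var_of l \<noteq> v" if "l \<in> C1" "l \<noteq> Pos v" for l
    using E1(4) that by (cases l) auto
  have C2: "var_of l \<noteq> v" if "l \<in> C2" "l \<noteq> Neg v" for l
    using E2(4) that by (cases l) auto
  let ?R = "(C1 - {Pos v}) \<union> (C2 - {Neg v})"
  have R: "var_of ` ?R \<subseteq> U" "\<forall>l\<in>?R. \<not> lit_true \<alpha> l"
    using restrict [OF _ E1(3,4)] restrict [OF _ E2(3,4)] C1 C2 by blast+
  show ?case
  proof (cases "Pos v \<in> C1 \<and> Neg v \<in> C2")
    case True
    then have "er_steps E2 1 (insert ?R E2)"
      using E1(2) E2(2) er_steps_subset [OF E2(1)]
      by (intro er_steps_resolve [of C1 _ C2]) (auto simp: is_resolvent_def)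
    then have "er_steps E (2 ^ card (insert v D) - 1) (insert ?R E2)"
      unfolding card by (rule er_steps_trans [OF E12])
    then show ?thesis using R by blast
  next
    case False
    then have "C1 \<subseteq> ?R \<or> C2 \<subseteq> ?R" by auto
    then obtain C where C: "C \<in> E2" "C \<subseteq> ?R"
      using E1(2) E2(2) er_steps_subset [OF E2(1)] by blast
    have "var_of ` C \<subseteq> U"
      using image_mono [OF C(2)] R(1) by (rule order_trans)
    moreover have "\<forall>l\<in>C. \<not> lit_true \<alpha> l"
      using C(2) R(2) by blast
    moreover have "er_steps E (2 ^ card (insert v D) - 1) E2"
      unfolding card by (rule er_steps_mono [OF E12]) simp
    ultimately show ?thesis using C(1) by blast
  qed
qed

text \<open>A sound inference among boundedly many variables costs boundedly many lines. As
  \<open>Q\<close> depends on \<open>ws\<close> alone, one clause per assignment to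
  \<open>ws\<close> suffices, and each arises by eliminating the other variables of
  \<open>vs\<close>. Lists in place of sets make the bound a numeral even if variables
  coincide.\<close>

lemma er_steps_blocks:
  assumes "blocks E V P" "V \<subseteq> set vs" "set ws \<subseteq> set vs"
    and PQ: "\<And>\<alpha>. P \<alpha> \<Longrightarrow> Q \<alpha>"
    and Q: "\<And>\<alpha> \<beta>. (\<And>v. v \<in> set ws \<Longrightarrow> \<alpha> v = \<beta> v) \<Longrightarrow> Q \<alpha> = Q \<beta>"
  shows "\<exists>E'. er_steps E (2 ^ length ws * 2 ^ length vs) E' \<and> blocks E' (set ws) Q"
proof -
  \<comment> \<open>Assignments are coded by the sets \<open>s\<close> of their true variables and
    are treated one after another.\<close>
  have *: "\<exists>E'. er_steps E (card N * 2 ^ length vs) E' \<and>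
      (\<forall>s\<in>N. \<not> Q (\<lambda>v. v \<in> s) \<longrightarrow>
        (\<exists>C\<in>E'. var_of ` C \<subseteq> set ws \<and> (\<forall>l\<in>C. \<not> lit_true (\<lambda>v. v \<in> s) l)))"
    if "finite N" for N
    using that
  proof (induction N rule: finite_induct)
    case empty
    then show ?case using er_steps_refl by auto
  next
    case (insert s N)
    then obtain E1 where E1: "er_steps E (card N * 2 ^ length vs) E1"
      "\<forall>s\<in>N. \<not> Q (\<lambda>v. v \<in> s) \<longrightarrow>
        (\<exists>C\<in>E1. var_of ` C \<subseteq> set ws \<and> (\<forall>l\<in>C. \<not> lit_true (\<lambda>v. v \<in> s) l))"
      by blast
    have "\<exists>E2. er_steps E1 (2 ^ length vs) E2 \<and> (\<not> Q (\<lambda>v. v \<in> s) \<longrightarrow>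
        (\<exists>C\<in>E2. var_of ` C \<subseteq> set ws \<and> (\<forall>l\<in>C. \<not> lit_true (\<lambda>v. v \<in> s) l)))"
    proof (cases "Q (\<lambda>v. v \<in> s)")
      case True
      then show ?thesis using er_steps_mono [OF er_steps_refl] by blast
    next
      case False
      have ex: "\<exists>C\<in>E1. var_of ` C \<subseteq> set ws \<union> (set vs - set ws) \<and> (\<forall>l\<in>C. \<not> lit_true \<beta> l)"
        if "\<forall>v\<in>set ws. \<beta> v = (v \<in> s)" for \<beta>
      proof -
        have "\<not> P \<beta>" using that False PQ Q [of \<beta> "\<lambda>v. v \<in> s"] by blast
        then obtain C where C: "C \<in> E" "var_of ` C \<subseteq> V" "\<forall>l\<in>C. \<not> lit_true \<beta> l"
          using assms(1) unfolding blocks_def by blast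
        have "C \<in> E1" using C(1) er_steps_subset [OF E1(1)] by (rule rev_subsetD)
        moreover have "var_of ` C \<subseteq> set ws \<union> (set vs - set ws)"
          using C(2) assms(2) by auto
        ultimately show ?thesis using C(3) by (intro bexI [of _ C] conjI)
      qed
      have disj: "(set vs - set ws) \<inter> set ws = {}" by blast
      obtain E2 where E2: "er_steps E1 (2 ^ card (set vs - set ws) - 1) E2"
        "\<exists>C\<in>E2. var_of ` C \<subseteq> set ws \<and> (\<forall>l\<in>C. \<not> lit_true (\<lambda>v. v \<in> s) l)"
        using er_steps_clause [where \<alpha> = "\<lambda>v. v \<in> s", OF finite_Diff [OF finite_set] disj ex] by blast
      have "card (set vs - set ws) \<le> length vs"
        using card_mono [of "set vs" "set vs - set ws"] card_length [of vs] by force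
      then have "(2 :: nat) ^ card (set vs - set ws) \<le> 2 ^ length vs" by simp
      then have "er_steps E1 (2 ^ length vs) E2"
        using er_steps_mono [OF E2(1)] by (meson diff_le_self order_trans)
      then show ?thesis using E2(2) by blast
    qed
    then obtain E2 where E2: "er_steps E1 (2 ^ length vs) E2" "\<not> Q (\<lambda>v. v \<in> s) \<longrightarrow>
        (\<exists>C\<in>E2. var_of ` C \<subseteq> set ws \<and> (\<forall>l\<in>C. \<not> lit_true (\<lambda>v. v \<in> s) l))"
      by blast
    have "er_steps E (card (insert s N) * 2 ^ length vs) E2"
      using er_steps_trans [OF E1(1) E2(1)] insert by (simp add: add.commute)
    moreover have "\<forall>t\<in>insert s N. \<not> Q (\<lambda>v. v \<in> t) \<longrightarrow>
        (\<exists>C\<in>E2. var_of ` C \<subseteq> set ws \<and> (\<forall>l\<in>C. \<not> lit_true (\<lambda>v. v \<in> t) l))"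
      using E1(2) E2(2) er_steps_subset [OF E2(1)] by (metis (no_types, lifting) insert_iff subsetD)
    ultimately show ?case by (intro exI conjI)
  qed
  obtain E' where E': "er_steps E (card (Pow (set ws)) * 2 ^ length vs) E'"
    and C: "\<And>s. s \<subseteq> set ws \<Longrightarrow> \<not> Q (\<lambda>v. v \<in> s) \<Longrightarrow>
        \<exists>C\<in>E'. var_of ` C \<subseteq> set ws \<and> (\<forall>l\<in>C. \<not> lit_true (\<lambda>v. v \<in> s) l)"
    using * [of "Pow (set ws)"] by auto
  have "blocks E' (set ws) Q"
    unfolding blocks_def
  proof (intro allI impI)
    fix \<alpha> assume "\<not> Q \<alpha>"
    \<comment> \<open>Only the values on \<open>ws\<close> matter, so \<open>\<alpha>\<close> may be
      replaced by the assignment that is false elsewhere.\<close>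
    let ?s = "{v \<in> set ws. \<alpha> v}"
    have "\<not> Q (\<lambda>v. v \<in> ?s)"
      using \<open>\<not> Q \<alpha>\<close> Q [of \<alpha> "\<lambda>v. v \<in> ?s"] by auto
    then obtain D where D: "D \<in> E'" "var_of ` D \<subseteq> set ws" "\<forall>l\<in>D. \<not> lit_true (\<lambda>v. v \<in> ?s) l"
      using C [of ?s] by blast
    have "\<not> lit_true \<alpha> l" if "l \<in> D" for l
      using D that lit_true_cong [of \<alpha> l "\<lambda>v. v \<in> ?s"] by auto
    then show "\<exists>C\<in>E'. var_of ` C \<subseteq> set ws \<and> (\<forall>l\<in>C. \<not> lit_true \<alpha> l)"
      using D by blast
  qed
  moreover have "card (Pow (set ws)) * 2 ^ length vs \<le> 2 ^ length ws * 2 ^ length vs"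
    by (simp add: card_Pow card_length)
  ultimately show ?thesis
    using er_steps_mono [OF E'] by blast
qed

section \<open>Parity chains\<close>

text \<open>One step of a running parity: \<open>p\<close> is its value before the literal
  \<open>l\<close> is read, \<open>q\<close> its value afterwards. Using \<open>blocks\<close>
  admits degenerate steps that follow from a unit clause.\<close>

definition xor3 :: "cnf \<Rightarrow> lit \<Rightarrow> lit \<Rightarrow> lit \<Rightarrow> bool" where
  "xor3 E p l q \<longleftrightarrow> blocks E {var_of p, var_of l, var_of q}
     (\<lambda>\<alpha>. lit_true \<alpha> q = (lit_true \<alpha> p \<noteq> lit_true \<alpha> l))"

text \<open>The running parities between the two ends are existentially quantified, because each
  splitting supplies new ones.\<close>

fun chain :: "cnf \<Rightarrow> lit \<Rightarrow> lit list \<Rightarrow> lit \<Rightarrow> bool" where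
  "chain E p [] r \<longleftrightarrow> p = r"
| "chain E p (l # L) r \<longleftrightarrow> (\<exists>q. xor3 E p l q \<and> chain E q L r)"

fun xor_val :: "(var \<Rightarrow> bool) \<Rightarrow> lit list \<Rightarrow> bool" where
  "xor_val \<alpha> [] \<longleftrightarrow> False"
| "xor_val \<alpha> (l # L) \<longleftrightarrow> (lit_true \<alpha> l \<noteq> xor_val \<alpha> L)"

lemma xor3_mono: "xor3 E p l q \<Longrightarrow> E \<subseteq> E' \<Longrightarrow> xor3 E' p l q"
  unfolding xor3_def by (erule blocks_mono) auto

lemma chain_mono: "chain E p L r \<Longrightarrow> E \<subseteq> E' \<Longrightarrow> chain E' p L r"
  by (induction L arbitrary: p) (auto dest: xor3_mono)

lemma chain_append: "chain E p L q \<Longrightarrow> chain E q M r \<Longrightarrow> chain E p (L @ M) r"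
  by (induction L arbitrary: p) auto

lemma chain_nth:
  assumes "\<And>j. j < length L \<Longrightarrow> xor3 E (q j) (L ! j) (q (Suc j))"
  shows "chain E (q 0) L (q (length L))"
  using assms
proof (induction L arbitrary: q)
  case (Cons l L)
  have "chain E (q (Suc 0)) L (q (Suc (length L)))"
    using Cons.IH [of "\<lambda>j. q (Suc j)"] Cons.prems [of "Suc _"] by simp
  then show ?case using Cons.prems [of 0] by auto
qed simp

lemma xor_val_append: "xor_val \<alpha> (L @ M) = (xor_val \<alpha> L \<noteq> xor_val \<alpha> M)"
  by (induction L) auto

lemma xor_val_filter:
  "xor_val \<alpha> L = (xor_val \<alpha> (filter P L) \<noteq> xor_val \<alpha> (filter (\<lambda>l. \<not> P l) L))"
  by (induction L) auto

lemma xor_val_cong: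
  "(\<And>l. l \<in> set L \<Longrightarrow> \<alpha> (var_of l) = \<beta> (var_of l)) \<Longrightarrow> xor_val \<alpha> L = xor_val \<beta> L"
  by (induction L) (auto simp: lit_true_cong [of \<alpha> _ \<beta>])

text \<open>Let \<open>?\<gamma>\<close> agree with \<open>\<beta>\<close> on \<open>Y\<close> and
  with \<open>\<alpha>\<close> elsewhere. Passing from \<open>\<alpha>\<close> to
  \<open>?\<gamma>\<close> changes neither the total parity nor the part outside \<open>Y\<close>,
  hence not the part inside \<open>Y\<close>.\<close>

lemma constant_xor_val_filter:
  assumes const: "\<And>\<alpha> \<beta>. xor_val \<alpha> L = xor_val \<beta> L"
  shows "xor_val \<alpha> (filter (\<lambda>l. var_of l \<in> Y) L) = xor_val \<beta> (filter (\<lambda>l. var_of l \<in> Y) L)"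
proof -
  let ?\<gamma> = "\<lambda>v. if v \<in> Y then \<beta> v else \<alpha> v"
  have "xor_val ?\<gamma> (filter (\<lambda>l. var_of l \<in> Y) L) = xor_val \<beta> (filter (\<lambda>l. var_of l \<in> Y) L)"
    "xor_val ?\<gamma> (filter (\<lambda>l. var_of l \<notin> Y) L) = xor_val \<alpha> (filter (\<lambda>l. var_of l \<notin> Y) L)"
    by (rule xor_val_cong; simp)+
  then show ?thesis
    using const [of \<alpha> ?\<gamma>] xor_val_filter [of \<alpha> L "\<lambda>l. var_of l \<in> Y"]
      xor_val_filter [of ?\<gamma> L "\<lambda>l. var_of l \<in> Y"] by auto
qed

section \<open>Clauses of ternary parity constraints\<close>

lemma var_of_negate [simp]: "var_of (negate l) = var_of l"
  by (cases l) auto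

lemma var_of_sign_clause: "var_of ` sign_clause ys P = var_of ` set ys"
proof -
  have "sign_clause ys P = (\<lambda>j. if j \<in> P then ys ! j else negate (ys ! j)) ` {..<length ys}"
    unfolding sign_clause_def by auto
  then have "var_of ` sign_clause ys P = (\<lambda>j. var_of (ys ! j)) ` {..<length ys}"
    by (simp only: image_image if_distrib [of var_of] var_of_negate if_cancel)
  also have "\<dots> = var_of ` set ys"
    by (auto simp: set_conv_nth)
  finally show ?thesis .
qed

lemma vars_xor_cnf3: "vars (xor_cnf [a, b, c]) = {var_of a, var_of b, var_of c}"
proof -
  have "var_of ` C = {var_of a, var_of b, var_of c}" if "C \<in> xor_cnf [a, b, c]" for C
    using that var_of_sign_clause [of "[a, b, c]"] unfolding xor_cnf_def by auto
  moreover have "sign_clause [a, b, c] {} \<in> xor_cnf [a, b, c]"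
    unfolding xor_cnf_def by auto
  moreover have "vars (xor_cnf [a, b, c]) = (\<Union>C\<in>xor_cnf [a, b, c]. var_of ` C)"
    unfolding vars_def by auto
  ultimately show ?thesis by auto
qed

lemma satisfies_xor_cnf3:
  "satisfies \<alpha> (xor_cnf [a, b, c]) \<longleftrightarrow> lit_true \<alpha> c = (lit_true \<alpha> a \<noteq> lit_true \<alpha> b)"
  unfolding satisfies_xor_cnf length_filter_conv_card [symmetric] by auto

text \<open>All position sets are counted, whatever their parity; the factor 2 lost affects only the
  constant.\<close>

lemma card_xor_cnf: "finite (xor_cnf ys)" "card (xor_cnf ys) \<le> 2 ^ length ys"
proof -
  have *: "xor_cnf ys \<subseteq> sign_clause ys ` Pow {..<length ys}"
    unfolding xor_cnf_def by auto
  then show "finite (xor_cnf ys)"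
    using finite_subset by blast
  have "card (xor_cnf ys) \<le> card (Pow {..<length ys})"
    using * by (meson card_image_le card_mono finite_Pow_iff finite_imageI finite_lessThan order_trans)
  then show "card (xor_cnf ys) \<le> 2 ^ length ys"
    by (simp add: card_Pow)
qed

lemma xor3_if_xor_cnf: "xor_cnf [a, b, c] \<subseteq> E \<Longrightarrow> xor3 E a b c"
  unfolding xor3_def
  by (rule blocks_satisfies) (auto simp: vars_xor_cnf3 satisfies_xor_cnf3)

section \<open>Splitting a chain into two partial chains\<close>

lemma er_steps_new_xor:
  assumes "finite (vars E)" "var_of p \<in> vars E" "var_of l \<in> vars E"
  shows "\<exists>E' q. er_steps E 8 E' \<and> xor3 E' p l q \<and> var_of q \<in> vars E'"
proof -
  obtain v where v: "v \<notin> vars E"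
    using assms(1) infinite_UNIV_nat ex_new_if_finite by blast
  \<comment> \<open>These clauses define \<open>v\<close> as the exclusive or of \<open>p\<close>
    and \<open>l\<close>; being ternary, they number at most \<open>2 ^ 3 = 8\<close>.\<close>
  let ?D = "xor_cnf [p, l, Pos v]"
  have "finite C" if "C \<in> ?D" for C
    using that unfolding xor_cnf_def sign_clause_def by auto
  then have "defines_as_function v [p, l] ?D"
    unfolding defines_as_function_def
    by (auto simp: vars_xor_cnf3 satisfies_xor_cnf3 intro!: exI [of _ "\<lambda>bs. bs ! 0 \<noteq> bs ! 1"])
  then have "er_steps E 8 (E \<union> ?D)"
    using v assms card_xor_cnf [of "[p, l, Pos v]"] by (intro er_steps_extend [of v _ "[p, l]"]) auto
  then show ?thesis
    by (intro exI [of _ "E \<union> ?D"] exI [of _ "Pos v"])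
      (auto simp: vars_Un vars_xor_cnf3 intro: xor3_if_xor_cnf)
qed

text \<open>Reading \<open>l\<close> flips the total \<open>p\<close> and the partial parity
  \<open>p1\<close> alike, so the relation to \<open>p2\<close> persists. Three variables are kept
  out of six, whence \<open>2 ^ 3 * 2 ^ 6 = 512\<close>.\<close>

lemma er_steps_xor3:
  assumes "xor3 E p1 p2 p" "xor3 E p l q" "xor3 E p1 l q1"
  shows "\<exists>E'. er_steps E 512 E' \<and> xor3 E' q1 p2 q"
proof -
  let ?Q = "\<lambda>\<alpha>. lit_true \<alpha> q = (lit_true \<alpha> q1 \<noteq> lit_true \<alpha> p2)"
  have "blocks E ({var_of p1, var_of p2, var_of p} \<union> {var_of p, var_of l, var_of q} \<union>
      {var_of p1, var_of l, var_of q1})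
    (\<lambda>\<alpha>. (lit_true \<alpha> p = (lit_true \<alpha> p1 \<noteq> lit_true \<alpha> p2) \<and>
      lit_true \<alpha> q = (lit_true \<alpha> p \<noteq> lit_true \<alpha> l)) \<and>
      lit_true \<alpha> q1 = (lit_true \<alpha> p1 \<noteq> lit_true \<alpha> l))"
    using assms unfolding xor3_def by (intro blocks_conj)
  then have "\<exists>E'. er_steps E (2 ^ length [var_of q1, var_of p2, var_of q] *
      2 ^ length [var_of p1, var_of p2, var_of p, var_of l, var_of q, var_of q1]) E' \<and>
    blocks E' (set [var_of q1, var_of p2, var_of q]) ?Q"
  proof (rule er_steps_blocks)
    fix \<alpha> \<beta> :: "var \<Rightarrow> bool"
    assume "\<And>v. v \<in> set [var_of q1, var_of p2, var_of q] \<Longrightarrow> \<alpha> v = \<beta> v"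
    then show "?Q \<alpha> = ?Q \<beta>"
      using lit_true_cong [of \<alpha> q1 \<beta>] lit_true_cong [of \<alpha> p2 \<beta>] lit_true_cong [of \<alpha> q \<beta>]
      by simp
  qed auto
  then show ?thesis unfolding xor3_def by auto
qed

lemma xor3_commute: "xor3 E p l q \<Longrightarrow> xor3 E l p q"
  unfolding xor3_def by (erule blocks_mono) auto

text \<open>
  Invariant: the value of the chain is the exclusive or of the values of the two partial chains, one
  of which advances with each literal.
\<close>

lemma chain_split:
  assumes "chain E p L r" "xor3 E p1 p2 p" "finite (vars E)"
    and "var_of p1 \<in> vars E" "var_of p2 \<in> vars E" "var_of ` set L \<subseteq> vars E"
  shows "\<exists>E' r1 r2. er_steps E (520 * length L) E' \<and> xor3 E' r1 r2 r \<and>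
    chain E' p1 (filter P L) r1 \<and> chain E' p2 (filter (\<lambda>l. \<not> P l) L) r2"
  using assms
proof (induction L arbitrary: E p p1 p2)
  case Nil
  then show ?case using er_steps_refl by auto
next
  case (Cons l L)
  \<comment> \<open>The partial chain at \<open>u\<close> reads \<open>l\<close> while the one at
    \<open>w\<close> waits: 8 lines define the new partial parity and 512 restore the invariant.
    Either partial chain can take the role of \<open>u\<close>, since \<open>xor3\<close> is
    symmetric in its first two literals.\<close>
  have one_side: "\<exists>E' q1 q. er_steps E 520 E' \<and> xor3 E' u l q1 \<and> xor3 E' q1 w q \<and>
      chain E' q L r \<and> var_of q1 \<in> vars E'"
    if uw: "xor3 E u w p" and u: "var_of u \<in> vars E" for u w
  proof -
    obtain q where q: "xor3 E p l q" "chain E q L r"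
      using Cons.prems(1) by auto
    obtain E1 q1 where E1: "er_steps E 8 E1" "xor3 E1 u l q1" "var_of q1 \<in> vars E1"
      using er_steps_new_xor [OF \<open>finite (vars E)\<close> u, of l] Cons.prems by auto
    obtain E2 where E2: "er_steps E1 512 E2" "xor3 E2 q1 w q"
      using er_steps_xor3 [of E1 u w p l q q1] uw q(1) E1(2) xor3_mono
        er_steps_subset [OF E1(1)] by blast
    have "er_steps E 520 E2" using er_steps_trans [OF E1(1) E2(1)] by simp
    then show ?thesis
      using E2(2) E1(2,3) q(2) er_steps_subset [OF E1(1)] er_steps_subset [OF E2(1)]
      by (meson chain_mono xor3_mono vars_mono subset_iff)
  qed
  show ?case
  proof (cases "P l")
    case True
    obtain E1 q1 q where E1: "er_steps E 520 E1" "xor3 E1 p1 l q1" "xor3 E1 q1 p2 q"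
      "chain E1 q L r" "var_of q1 \<in> vars E1"
      using one_side [of p1 p2] Cons.prems by blast
    have "var_of p1 \<in> vars E1" "var_of p2 \<in> vars E1" "var_of ` set L \<subseteq> vars E1"
      using Cons.prems vars_mono [OF er_steps_subset [OF E1(1)]] by auto
    then obtain E2 r1 r2 where E2: "er_steps E1 (520 * length L) E2" "xor3 E2 r1 r2 r"
      "chain E2 q1 (filter P L) r1" "chain E2 p2 (filter (\<lambda>l. \<not> P l) L) r2"
      using Cons.IH [OF E1(4,3) er_steps_finite_vars [OF E1(1)] E1(5)] Cons.prems by auto
    have "chain E2 p1 (filter P (l # L)) r1"
      using True E2(3) xor3_mono [OF E1(2) er_steps_subset [OF E2(1)]] by auto
    then show ?thesis
      using True er_steps_trans [OF E1(1) E2(1)] E2(2,4) by auto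
  next
    case False
    obtain E1 q2 q where E1: "er_steps E 520 E1" "xor3 E1 p2 l q2" "xor3 E1 q2 p1 q"
      "chain E1 q L r" "var_of q2 \<in> vars E1"
      using one_side [of p2 p1] Cons.prems xor3_commute by blast
    have "var_of p1 \<in> vars E1" "var_of p2 \<in> vars E1" "var_of ` set L \<subseteq> vars E1"
      using Cons.prems vars_mono [OF er_steps_subset [OF E1(1)]] by auto
    then obtain E2 r1 r2 where E2: "er_steps E1 (520 * length L) E2" "xor3 E2 r1 r2 r"
      "chain E2 p1 (filter P L) r1" "chain E2 q2 (filter (\<lambda>l. \<not> P l) L) r2"
      using Cons.IH [OF E1(4) xor3_commute [OF E1(3)] er_steps_finite_vars [OF E1(1)] _ E1(5)]
        Cons.prems by auto
    have "chain E2 p2 (filter (\<lambda>l. \<not> P l) (l # L)) r2"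
      using False E2(4) xor3_mono [OF E1(2) er_steps_subset [OF E2(1)]] by auto
    then show ?thesis
      using False er_steps_trans [OF E1(1) E2(1)] E2(2,3) by auto
  qed
qed

section \<open>Constant parities\<close>

lemma chain_one_variable:
  assumes "chain E p L r" "var_of ` set L \<subseteq> {v}"
    and "blocks E {var_of p, v} (\<lambda>\<alpha>. lit_true \<alpha> p = g (\<alpha> v))"
  shows "\<exists>E'. er_steps E (32 * length L) E' \<and>
    blocks E' {var_of r, v} (\<lambda>\<alpha>. lit_true \<alpha> r = (g (\<alpha> v) \<noteq> xor_val \<alpha> L))"
  using assms
proof (induction L arbitrary: E p g)
  case Nil
  then show ?case using er_steps_refl by auto
next
  case (Cons l L)
  have v: "var_of l = v" using Cons.prems by auto
  obtain h where h: "\<And>\<alpha>. lit_true \<alpha> l = h (\<alpha> v)"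
    using v by (cases l) (auto intro: that [of "\<lambda>b. b"] that [of Not])
  obtain q where q: "xor3 E p l q" "chain E q L r"
    using Cons.prems(1) by auto
  let ?Q = "\<lambda>\<alpha>. lit_true \<alpha> q = (g (\<alpha> v) \<noteq> h (\<alpha> v))"
  have "blocks E ({var_of p, v} \<union> {var_of p, var_of l, var_of q})
    (\<lambda>\<alpha>. lit_true \<alpha> p = g (\<alpha> v) \<and> lit_true \<alpha> q = (lit_true \<alpha> p \<noteq> lit_true \<alpha> l))"
    using Cons.prems(3) q(1) unfolding xor3_def by (rule blocks_conj)
  then have "\<exists>E'. er_steps E (2 ^ length [var_of q, v] * 2 ^ length [var_of p, v, var_of q]) E' \<and>
      blocks E' (set [var_of q, v]) ?Q"
  proof (rule er_steps_blocks)
    fix \<alpha> \<beta> :: "var \<Rightarrow> bool" assume "\<And>w. w \<in> set [var_of q, v] \<Longrightarrow> \<alpha> w = \<beta> w"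
    then show "?Q \<alpha> = ?Q \<beta>" using lit_true_cong [of \<alpha> q \<beta>] by simp
  qed (auto simp: v h)
  then obtain E1 where E1: "er_steps E 32 E1" "blocks E1 {var_of q, v} ?Q"
    by auto
  have "chain E1 q L r" using q(2) er_steps_subset [OF E1(1)] chain_mono by blast
  then obtain E2 where E2: "er_steps E1 (32 * length L) E2"
    "blocks E2 {var_of r, v} (\<lambda>\<alpha>. lit_true \<alpha> r = ((g (\<alpha> v) \<noteq> h (\<alpha> v)) \<noteq> xor_val \<alpha> L))"
    using Cons.IH [OF _ _ E1(2)] Cons.prems by auto
  have "er_steps E (32 * length (l # L)) E2"
    using er_steps_trans [OF E1(1) E2(1)] by simp
  moreover have "blocks E2 {var_of r, v} (\<lambda>\<alpha>. lit_true \<alpha> r = (g (\<alpha> v) \<noteq> xor_val \<alpha> (l # L)))"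
    using E2(2) by (rule blocks_mono) (auto simp: h)
  ultimately show ?case by blast
qed

lemma split_finite_set:
  assumes "finite Y" "card Y \<le> k + l"
  obtains Y1 where "Y1 \<subseteq> Y" "card Y1 \<le> k" "card (Y - Y1) \<le> l"
proof -
  obtain Y1 where "Y1 \<subseteq> Y" "card Y1 = min k (card Y)"
    using obtain_subset_with_card_n [of "min k (card Y)" Y] by auto
  then show ?thesis
    using that [of Y1] assms by (auto simp: card_Diff_subset finite_subset)
qed

text \<open>Divide and conquer on \<open>Y\<close>. Each literal lies in one chain per level, which
  gives the term \<open>(d + 1) * length L\<close>; the term \<open>2 ^ (d + 1)\<close> pays for the
  nodes of the splitting tree. The spare 520 strengthens the induction: two recursive bounds leave
  room for the lines that recombine them.\<close>

lemma chain_constant: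
  assumes "chain E (Pos z) L r" "{Neg z} \<in> E" "finite (vars E)"
    and "var_of ` set L \<subseteq> Y \<inter> vars E" "finite Y" "card Y \<le> 2 ^ d"
    and "\<And>\<alpha> \<beta>. xor_val \<alpha> L = xor_val \<beta> L"
  shows "\<exists>E' k. er_steps E k E' \<and> k + 520 \<le> 520 * ((d + 1) * length L + 2 ^ (d + 1)) \<and>
    blocks E' {var_of r} (\<lambda>\<alpha>. lit_true \<alpha> r = xor_val \<alpha> L)"
  using assms
proof (induction d arbitrary: E L r Y)
  case 0
  obtain v where v: "Y \<subseteq> {v}"
    using 0 by (metis One_nat_def card_le_Suc0_iff_eq insertI1 power_0 subsetI empty_iff insert_iff)
  have "blocks E {var_of (Pos z), v} (\<lambda>\<alpha>. lit_true \<alpha> (Pos z) = (\<lambda>_. False) (\<alpha> v))"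
    using 0(2) by (intro blocks_satisfies [of "{{Neg z}}"]) (auto simp: vars_def satisfies_def)
  moreover have "var_of ` set L \<subseteq> {v}" using 0(4) v by auto
  ultimately obtain E1 where E1: "er_steps E (32 * length L) E1"
    "blocks E1 {var_of r, v} (\<lambda>\<alpha>. lit_true \<alpha> r = xor_val \<alpha> L)"
    using chain_one_variable [OF 0(1), of v "\<lambda>_. False"] by auto
  \<comment> \<open>Since the parity of \<open>L\<close> is constant, the constraint no longer
    depends on \<open>v\<close>, which can be eliminated.\<close>
  have "\<exists>E'. er_steps E1 (2 ^ length [var_of r] * 2 ^ length [var_of r, v]) E' \<and>
      blocks E' (set [var_of r]) (\<lambda>\<alpha>. lit_true \<alpha> r = xor_val \<alpha> L)"
    using E1(2)
  proof (rule er_steps_blocks)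
    fix \<alpha> \<beta> :: "var \<Rightarrow> bool" assume "\<And>w. w \<in> set [var_of r] \<Longrightarrow> \<alpha> w = \<beta> w"
    then show "(lit_true \<alpha> r = xor_val \<alpha> L) = (lit_true \<beta> r = xor_val \<beta> L)"
      using lit_true_cong [of \<alpha> r \<beta>] 0(7) [of \<alpha> \<beta>] by simp
  qed auto
  then obtain E2 where E2: "er_steps E1 8 E2" "blocks E2 {var_of r} (\<lambda>\<alpha>. lit_true \<alpha> r = xor_val \<alpha> L)"
    by auto
  then show ?case
    using er_steps_trans [OF E1(1) E2(1)]
    by (intro exI [of _ E2] exI [of _ "32 * length L + 8"]) auto
next
  case (Suc d)
  obtain Y1 where Y1: "Y1 \<subseteq> Y" "card Y1 \<le> 2 ^ d" "card (Y - Y1) \<le> 2 ^ d"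
    using split_finite_set [of Y "2 ^ d" "2 ^ d"] Suc.prems by auto
  let ?L1 = "filter (\<lambda>l. var_of l \<in> Y1) L" and ?L2 = "filter (\<lambda>l. var_of l \<notin> Y1) L"
  have const1: "xor_val \<alpha> ?L1 = xor_val \<beta> ?L1" for \<alpha> \<beta>
    using constant_xor_val_filter [OF Suc.prems(7)] by blast
  have const2: "xor_val \<alpha> ?L2 = xor_val \<beta> ?L2" for \<alpha> \<beta>
    using constant_xor_val_filter [OF Suc.prems(7), of \<alpha> "- Y1" \<beta>] by simp
  have z: "z \<in> vars E"
    using Suc.prems(2) unfolding vars_def by force
  \<comment> \<open>Both partial chains start at the false literal, as false is the exclusive or of
    false with itself.\<close>
  have "xor3 E (Pos z) (Pos z) (Pos z)"
    unfolding xor3_def using Suc.prems(2)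
    by (intro blocks_satisfies [of "{{Neg z}}"]) (auto simp: vars_def satisfies_def)
  then obtain E1 r1 r2 where E1: "er_steps E (520 * length L) E1" "xor3 E1 r1 r2 r"
    "chain E1 (Pos z) ?L1 r1" "chain E1 (Pos z) ?L2 r2"
    using chain_split [OF Suc.prems(1), of "Pos z" "Pos z" "\<lambda>l. var_of l \<in> Y1"] Suc.prems z
    by auto
  note sub1 = er_steps_subset [OF E1(1)] and fin1 = er_steps_finite_vars [OF E1(1) Suc.prems(3)]
  have "var_of ` set ?L1 \<subseteq> Y1 \<inter> vars E1"
    using Suc.prems(4) vars_mono [OF sub1] by auto
  then obtain E2 k2 where E2: "er_steps E1 k2 E2"
    "k2 + 520 \<le> 520 * ((d + 1) * length ?L1 + 2 ^ (d + 1))"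
    "blocks E2 {var_of r1} (\<lambda>\<alpha>. lit_true \<alpha> r1 = xor_val \<alpha> ?L1)"
    using Suc.IH [OF E1(3) _ fin1 _ _ Y1(2) const1] Suc.prems(2,5) sub1 Y1(1) finite_subset by blast
  note sub2 = er_steps_subset [OF E2(1)] and fin2 = er_steps_finite_vars [OF E2(1) fin1]
  have "var_of ` set ?L2 \<subseteq> (Y - Y1) \<inter> vars E2"
    using Suc.prems(4) vars_mono [OF order_trans [OF sub1 sub2]] by auto
  \<comment> \<open>The second recursive call starts from the clauses left by the first, so the two
    costs add up.\<close>
  then obtain E3 k3 where E3: "er_steps E2 k3 E3"
    "k3 + 520 \<le> 520 * ((d + 1) * length ?L2 + 2 ^ (d + 1))"
    "blocks E3 {var_of r2} (\<lambda>\<alpha>. lit_true \<alpha> r2 = xor_val \<alpha> ?L2)"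
    using Suc.IH [OF chain_mono [OF E1(4) sub2] _ fin2 _ _ Y1(3) const2]
      Suc.prems(2,5) sub1 sub2 finite_Diff by blast
  note sub3 = er_steps_subset [OF E3(1)]
  have "blocks E3 (({var_of r1} \<union> {var_of r2}) \<union> {var_of r1, var_of r2, var_of r})
    (\<lambda>\<alpha>. (lit_true \<alpha> r1 = xor_val \<alpha> ?L1 \<and> lit_true \<alpha> r2 = xor_val \<alpha> ?L2) \<and>
      lit_true \<alpha> r = (lit_true \<alpha> r1 \<noteq> lit_true \<alpha> r2))"
    using blocks_mono [OF E2(3) sub3] E3(3) xor3_mono [OF E1(2), of E3] sub2 sub3
    unfolding xor3_def by (intro blocks_conj) auto
  then have "\<exists>E'. er_steps E3 (2 ^ length [var_of r] * 2 ^ length [var_of r1, var_of r2, var_of r]) E' \<and>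
      blocks E' (set [var_of r]) (\<lambda>\<alpha>. lit_true \<alpha> r = xor_val \<alpha> L)"
  proof (rule er_steps_blocks)
    fix \<alpha> \<beta> :: "var \<Rightarrow> bool" assume "\<And>w. w \<in> set [var_of r] \<Longrightarrow> \<alpha> w = \<beta> w"
    then show "(lit_true \<alpha> r = xor_val \<alpha> L) = (lit_true \<beta> r = xor_val \<beta> L)"
      using lit_true_cong [of \<alpha> r \<beta>] Suc.prems(7) [of \<alpha> \<beta>] by simp
  qed (auto simp: xor_val_filter [of _ L "\<lambda>l. var_of l \<in> Y1"])
  then obtain E4 where E4: "er_steps E3 16 E4" "blocks E4 {var_of r} (\<lambda>\<alpha>. lit_true \<alpha> r = xor_val \<alpha> L)"
    by auto
  let ?k = "520 * length L + k2 + k3 + 16"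
  have "er_steps E ?k E4"
    by (intro er_steps_trans [OF _ E4(1)] er_steps_trans [OF _ E3(1)] er_steps_trans [OF E1(1) E2(1)])
  moreover have "?k + 520 \<le> 520 * ((Suc d + 1) * length L + 2 ^ (Suc d + 1))"
  proof -
    have "length L = length ?L1 + length ?L2"
      by (rule sum_length_filter_compl [symmetric])
    then have "(d + 1) * length L = (d + 1) * length ?L1 + (d + 1) * length ?L2"
      by (metis distrib_left)
    then show ?thesis
      using E2(2) E3(2) by simp
  qed
  ultimately show ?case using E4(2) by blast
qed

section \<open>The refutation\<close>

text \<open>
  The prefix literals are \<open>0, y\<^sub>1, t\<^sub>1, \<dots>, t\<^sub>m\<^sub>-\<^sub>3, y\<^sub>m, 0\<close>, where \<open>0\<close> is the
  false literal \<open>Pos z\<close>.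
\<close>

lemma linear_encoding_chain:
  assumes "length ys \<ge> 4" "length ts = length ys - 3" "linear_encoding ys ts \<subseteq> E" "{Neg z} \<in> E"
  shows "chain E (Pos z) ys (Pos z)" "var_of ` set ys \<subseteq> vars E"
proof -
  define m where "m = length ys"
  \<comment> \<open>\<open>q j\<close> stands for the parity of the first \<open>j\<close> literals.
    Tseitin variables are listed from position 0 and begin at \<open>j = 2\<close>, hence the shift.
    At \<open>j = m - 1\<close> the last literal itself serves, because the total parity is
    0.\<close>
  define q where "q j = (if j = 0 \<or> j = m then Pos z else if j = 1 then ys ! 0
    else if j = m - 1 then ys ! (m - 1) else Pos (ts ! (j - 2)))" for j
  have m: "m \<ge> 4" using assms(1) m_def by simp
  have parts: "xor_cnf [ys ! (1 - 1), ys ! (2 - 1), Pos (ts ! (1 - 1))] \<subseteq> E"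
    "\<forall>j\<in>{1..m - 4}. xor_cnf [Pos (ts ! (j - 1)), ys ! (j + 2 - 1), Pos (ts ! (j + 1 - 1))] \<subseteq> E"
    "xor_cnf [Pos (ts ! (m - 3 - 1)), ys ! (m - 1 - 1), ys ! (m - 1)] \<subseteq> E"
    using assms(3) unfolding linear_encoding_def Let_def m_def Un_subset_iff UN_subset_iff
    by - (elim conjE, assumption)+
  have first: "xor_cnf [ys ! 0, ys ! 1, Pos (ts ! 0)] \<subseteq> E"
    using parts(1) by simp
  have last: "xor_cnf [Pos (ts ! (m - 4)), ys ! (m - 2), ys ! (m - 1)] \<subseteq> E"
  proof -
    have "m - 3 - 1 = m - 4" "m - 1 - 1 = m - 2" by auto
    then show ?thesis using parts(3) by (simp only:)
  qed
  have mid: "xor_cnf [Pos (ts ! (j - 2)), ys ! j, Pos (ts ! (j - 1))] \<subseteq> E" if "2 \<le> j" "j < m - 2" for j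
  proof -
    have "j - 1 \<in> {1..m - 4}" and *: "j - 1 - 1 = j - 2" "j - 1 + 2 - 1 = j" "j - 1 + 1 - 1 = j - 1"
      using that by auto
    then show ?thesis
      using bspec [OF parts(2), of "j - 1"] unfolding * by blast
  qed
  \<comment> \<open>False is neutral and every literal cancels itself; this supplies the first and
    the last step of the chain, which have no clauses of their own in the encoding.\<close>
  have xor3_0: "xor3 E (Pos z) l l" "xor3 E l l (Pos z)" for l
    unfolding xor3_def using assms(4)
    by (intro blocks_satisfies [of "{{Neg z}}"]; auto simp: vars_def satisfies_def)+
  have cases: "j = 0 \<or> j = 1 \<or> (2 \<le> j \<and> j < m - 2) \<or> j = m - 2 \<or> j = m - 1" if "j < m" for j
    using that by linarith
  have "xor3 E (q j) (ys ! j) (q (Suc j))" if "j < m" for j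
    using cases [OF that]
  proof (elim disjE)
    assume "j = 0"
    then show ?thesis using m xor3_0 by (simp add: q_def)
  next
    assume "j = 1"
    then show ?thesis using m xor3_if_xor_cnf [OF first] by (auto simp: q_def numeral_eq_Suc)
  next
    assume "2 \<le> j \<and> j < m - 2"
    then show ?thesis using m xor3_if_xor_cnf [OF mid [of j]] by (auto simp: q_def)
  next
    assume "j = m - 2"
    moreover have "Suc (m - 2) = m - 1" "m - 2 - 2 = m - 4" using m by auto
    ultimately show ?thesis using m xor3_if_xor_cnf [OF last] by (auto simp: q_def)
  next
    assume "j = m - 1"
    moreover have "Suc (m - 1) = m" using m by auto
    ultimately show ?thesis using m xor3_0 by (auto simp: q_def)
  qed
  then have "chain E (q 0) ys (q (length ys))"
    unfolding m_def by (rule chain_nth)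
  then show "chain E (Pos z) ys (Pos z)" by (simp add: q_def m_def)
  have "var_of (ys ! j) \<in> vars E" if "j < m" for j
    using cases [OF that]
  proof (elim disjE)
    assume "2 \<le> j \<and> j < m - 2"
    then show ?thesis using vars_mono [OF mid [of j]] unfolding vars_xor_cnf3 by simp
  qed (use vars_mono [OF first] vars_mono [OF last] in \<open>simp_all add: vars_xor_cnf3\<close>)
  then show "var_of ` set ys \<subseteq> vars E"
    unfolding m_def by (auto simp: set_conv_nth)
qed

lemma finite_vars_linear_encoding: "finite (vars (linear_encoding ys ts))"
proof -
  have "vars (\<Union>j\<in>J. D j) = (\<Union>j\<in>J. vars (D j))" for J :: "nat set" and D
    unfolding vars_def by auto
  then show ?thesis
    unfolding linear_encoding_def Let_def vars_Un by (simp add: vars_xor_cnf3)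
qed

text \<open>A refutation needs the empty clause among its own lines; this excludes that it was found
  in the formula instead.\<close>

lemma empty_notin_linear_encoding: "{} \<notin> linear_encoding ys ts"
proof -
  have "{} \<notin> xor_cnf [a, b, c]" for a b c
  proof
    assume "{} \<in> xor_cnf [a, b, c]"
    then obtain P where "sign_clause [a, b, c] P = {}"
      unfolding xor_cnf_def by blast
    with var_of_sign_clause [of "[a, b, c]" P] show False by simp
  qed
  then show ?thesis unfolding linear_encoding_def Let_def by simp
qed

section \<open>The parity of the three concatenated lists\<close>

lemma xor_val_map_Pos: "distinct vs \<Longrightarrow> xor_val \<alpha> (map Pos vs) = odd (card {v \<in> set vs. \<alpha> v})"
proof (induction vs)
  case (Cons v vs)
  have "{w \<in> set (v # vs). \<alpha> w} = (if \<alpha> v then insert v {w \<in> set vs. \<alpha> w} else {w \<in> set vs. \<alpha> w})"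
    by auto
  then show ?case using Cons by auto
qed simp

text \<open>As \<open>vs\<close> is distinct, at most one literal is negated, and negating it flips
  the parity.\<close>

lemma xor_val_negate_one:
  "distinct vs \<Longrightarrow> xor_val \<alpha> (map (\<lambda>v. if v = z then Neg v else Pos v) vs) =
    (xor_val \<alpha> (map Pos vs) \<noteq> (z \<in> set vs))"
  by (induction vs) auto

text \<open>Both cardinalities contain that of the intersection, which cancels modulo 2.\<close>

lemma odd_card_sym_diff:
  assumes "finite A" "finite B"
  shows "odd (card (sym_diff A B)) \<longleftrightarrow> odd (card A) \<noteq> odd (card B)"
proof -
  have "card (sym_diff A B) = card (A - B) + card (B - A)"
    using assms by (intro card_Un_disjoint) auto
  moreover have "card A = card (A - B) + card (A \<inter> B)" "card B = card (B - A) + card (A \<inter> B)"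
    using assms by (subst card_Un_disjoint [symmetric]; auto intro: arg_cong [where f = card])+
  ultimately show ?thesis by auto
qed

lemma rAddPar_refutation:
  assumes "distinct X" "set \<sigma>a \<subseteq> set X" "set \<sigma>b \<subseteq> set X"
    and a: "is_parity (set \<sigma>a) S \<sigma>a" and b: "is_parity (set \<sigma>b) T \<sigma>b"
    and c: "is_parity C U (sym_diff_list X (set \<sigma>a) (set \<sigma>b))"
    and z: "z \<in> sym_diff (set \<sigma>a) (set \<sigma>b)"
    and "length X \<le> 2 ^ d"
  shows "\<exists>\<pi>. ER_refutation (rAddPar X \<sigma>a S \<sigma>b T U z) \<pi> \<and>
    length \<pi> \<le> 520 * ((d + 1) * (3 * length X) + 2 ^ (d + 1))"
proof -
  define F where "F = rAddPar X \<sigma>a S \<sigma>b T U z"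
  define \<sigma>c where "\<sigma>c = sym_diff_list X (set \<sigma>a) (set \<sigma>b)"
  let ?sg = "\<lambda>v. if v = z then Neg v else Pos v"
  define L where "L = map Pos \<sigma>a @ map Pos \<sigma>b @ map ?sg \<sigma>c"
  have F: "F = linear_encoding (map Pos \<sigma>a) S \<union> linear_encoding (map Pos \<sigma>b) T \<union>
      linear_encoding (map ?sg \<sigma>c) U"
    unfolding F_def rAddPar_def \<sigma>c_def ..
  have fin: "finite (vars F)"
    unfolding F vars_Un using finite_vars_linear_encoding by blast
  have set_c: "set \<sigma>c = sym_diff (set \<sigma>a) (set \<sigma>b)"
    using assms(2,3) unfolding \<sigma>c_def sym_diff_list_def by auto
  have dist: "distinct \<sigma>a" "distinct \<sigma>b" "distinct \<sigma>c"
    using a b c unfolding is_parity_def \<sigma>c_def by auto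
  have len: "length \<sigma>a \<le> length X" "length \<sigma>b \<le> length X" "length \<sigma>c \<le> length X"
    using assms(1-3) dist set_c
    by (metis card_mono distinct_card finite_set, metis card_mono distinct_card finite_set,
        simp add: \<sigma>c_def sym_diff_list_def)
  \<comment> \<open>Every variable of \<open>L\<close> occurs in exactly two of the three lists, so
    all values cancel; the one negated literal leaves the constant true.\<close>
  have L_val: "xor_val \<alpha> L" for \<alpha>
  proof -
    have "{v \<in> set \<sigma>c. \<alpha> v} = sym_diff {v \<in> set \<sigma>a. \<alpha> v} {v \<in> set \<sigma>b. \<alpha> v}"
      unfolding set_c by auto
    then have "odd (card {v \<in> set \<sigma>c. \<alpha> v}) =
        (odd (card {v \<in> set \<sigma>a. \<alpha> v}) \<noteq> odd (card {v \<in> set \<sigma>b. \<alpha> v}))"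
      using odd_card_sym_diff [of "{v \<in> set \<sigma>a. \<alpha> v}" "{v \<in> set \<sigma>b. \<alpha> v}"] by simp
    then show ?thesis
      using z set_c dist
      by (simp add: L_def xor_val_append xor_val_negate_one xor_val_map_Pos) argo
  qed
  obtain w where w: "w \<notin> vars F"
    using fin infinite_UNIV_nat ex_new_if_finite by blast
  let ?E = "F \<union> {{Neg w}}"
  \<comment> \<open>The constant false is a function of no arguments, so the unit clause
    \<open>{Neg w}\<close> is a legitimate definition.\<close>
  have "defines_as_function w [] {{Neg w}}"
    unfolding defines_as_function_def vars_def satisfies_def
    by (auto intro!: exI [of _ "\<lambda>_. False"])
  then have E: "er_steps F 1 ?E"
    using w by (intro er_steps_extend [of w _ "[]"]) auto
  have len4: "length (map Pos \<sigma>a) \<ge> 4" "length S = length (map Pos \<sigma>a) - 3"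
    "length (map Pos \<sigma>b) \<ge> 4" "length T = length (map Pos \<sigma>b) - 3"
    "length (map ?sg \<sigma>c) \<ge> 4" "length U = length (map ?sg \<sigma>c) - 3"
    using a b c unfolding is_parity_def \<sigma>c_def by auto
  have sub: "linear_encoding (map Pos \<sigma>a) S \<subseteq> ?E" "linear_encoding (map Pos \<sigma>b) T \<subseteq> ?E"
    "linear_encoding (map ?sg \<sigma>c) U \<subseteq> ?E"
    unfolding F by blast+
  have "{Neg w} \<in> ?E" by simp
  note chains = linear_encoding_chain [OF len4(1,2) sub(1) this]
    linear_encoding_chain [OF len4(3,4) sub(2) this] linear_encoding_chain [OF len4(5,6) sub(3) this]
  have chain: "chain ?E (Pos w) L (Pos w)"
    unfolding L_def by (rule chain_append [OF chains(1) chain_append [OF chains(3,5)]])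
  moreover have "var_of ` set L \<subseteq> vars ?E"
    using chains(2,4,6) unfolding L_def set_append image_Un by blast
  moreover have "var_of ` set L \<subseteq> set X"
    using assms(2,3) set_c unfolding L_def by auto
  moreover have "card (set X) \<le> 2 ^ d"
    using assms(8) card_length [of X] by linarith
  ultimately obtain E1 k where E1: "er_steps ?E k E1"
    "k + 520 \<le> 520 * ((d + 1) * length L + 2 ^ (d + 1))"
    "blocks E1 {var_of (Pos w)} (\<lambda>\<alpha>. lit_true \<alpha> (Pos w) = xor_val \<alpha> L)"
    using chain_constant [of ?E w L "Pos w" "set X" d] er_steps_finite_vars [OF E fin] L_val by auto
  \<comment> \<open>The chain forces \<open>w\<close> to be true while its definition makes it
    false; eliminating \<open>w\<close> leaves the empty clause.\<close>
  have "blocks E1 ({w} \<union> {w}) (\<lambda>\<alpha>. lit_true \<alpha> (Pos w) = xor_val \<alpha> L \<and> \<not> \<alpha> w)"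
    using E1(3) er_steps_subset [OF E1(1)]
    by (intro blocks_conj blocks_satisfies [of "{{Neg w}}" _ _ "\<lambda>\<alpha>. \<not> \<alpha> w"])
      (auto simp: vars_def satisfies_def)
  then have "\<exists>E'. er_steps E1 (2 ^ length ([] :: var list) * 2 ^ length [w]) E' \<and>
      blocks E' (set []) (\<lambda>_. False)"
    by (rule er_steps_blocks) (auto simp: L_val)
  then obtain E2 where E2: "er_steps E1 2 E2" "blocks E2 {} (\<lambda>_. False)"
    by auto
  have "{} \<in> E2"
    using E2(2) unfolding blocks_def by auto
  moreover have "{} \<notin> F"
    unfolding F using empty_notin_linear_encoding by blast
  \<comment> \<open>One line introduces \<open>w\<close> and two suffice for the final
    contradiction; the spare 520 in the bound on \<open>k\<close> absorbs them.\<close>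
  moreover obtain \<pi> where "ER_derivation F \<pi>" "E2 = F \<union> set \<pi>" "length \<pi> \<le> 1 + k + 2"
    using er_steps_trans [OF er_steps_trans [OF E E1(1)] E2(1)] unfolding er_steps_def by blast
  moreover have "(d + 1) * length L \<le> (d + 1) * (3 * length X)"
    using len by (intro mult_le_mono2) (simp add: L_def)
  ultimately show ?thesis
    using E1(2) unfolding ER_refutation_def F_def [symmetric] by (intro exI [of _ \<pi>]) auto
qed

theorem theorem4:
  shows "\<exists>f :: nat \<Rightarrow> real. f \<in> O(\<lambda>n. real n * ln (real n)) \<and>
    (\<forall>(n :: nat) (X :: var list) (A :: var set) (B :: var set)
       (\<sigma>a :: var list) (\<sigma>b :: var list) (S :: var list) (T :: var list) (U :: var list) (z :: var).
       length X = n \<and> distinct X \<and> A \<subseteq> set X \<and> B \<subseteq> set X \<and>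
       is_parity A S \<sigma>a \<and> is_parity B T \<sigma>b \<and>
       is_parity (sym_diff A B) U (sym_diff_list X A B) \<and> z \<in> sym_diff A B \<and>
       set S \<inter> set T = {} \<and> set S \<inter> set U = {} \<and> set T \<inter> set U = {} \<and>
       set S \<inter> set X = {} \<and> set T \<inter> set X = {} \<and> set U \<inter> set X = {}
       \<longrightarrow> (\<exists>\<pi>. ER_refutation (rAddPar X \<sigma>a S \<sigma>b T U z) \<pi> \<and> real (length \<pi>) \<le> f n))"
proof -
  \<comment> \<open>With \<open>2 ^ d \<le> n < 2 ^ (d + 1)\<close>, depth \<open>d + 1\<close>
    suffices: its level factor \<open>d + 2\<close> is at most \<open>log 2 n + 2\<close>, and
    \<open>2 ^ (d + 2)\<close> is at most \<open>4 * n\<close>.\<close>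
  define f :: "nat \<Rightarrow> real"
    where "f n = 520 * ((log 2 (real n) + 2) * (3 * real n) + 4 * real n)" for n
  have big: "f \<in> O(\<lambda>n. real n * ln (real n))"
  proof (rule landau_o.bigI)
    show "520 * (3 / ln 2 + 10) > (0 :: real)"
      by (intro mult_pos_pos add_pos_pos divide_pos_pos) auto
    \<comment> \<open>The linear terms sum to \<open>6 * n + 4 * n\<close>, and they are absorbed
      because \<open>ln n\<close> is at least 1 from \<open>n = 3\<close> on.\<close>
    have bound: "norm (f n) \<le> 520 * (3 / ln 2 + 10) * norm (real n * ln (real n))" if "n \<ge> 3" for n
    proof -
      have "exp 1 \<le> real n" using exp_le that by linarith
      then have ln: "1 \<le> ln (real n)"
        using that by (subst ln_ge_iff) auto
      then have "real n \<le> real n * ln (real n)"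
        by (simp add: mult_le_cancel_left1)
      moreover have "f n = 520 * (3 / ln 2 * (real n * ln (real n)) + 10 * real n)"
        unfolding f_def log_def by (simp add: algebra_simps)
      ultimately have "f n \<le> 520 * (3 / ln 2 * (real n * ln (real n)) + 10 * (real n * ln (real n)))"
        by simp
      moreover have "f n \<ge> 0"
        unfolding f_def log_def using ln by (intro mult_nonneg_nonneg add_nonneg_nonneg) auto
      ultimately show ?thesis
        using ln by (simp add: algebra_simps)
    qed
    show "\<forall>\<^sub>F n in sequentially. norm (f n) \<le> 520 * (3 / ln 2 + 10) * norm (real n * ln (real n))"
      by (rule eventually_mono [OF eventually_ge_at_top bound])
  qed
  have refutation: "\<exists>\<pi>. ER_refutation (rAddPar X \<sigma>a S \<sigma>b T U z) \<pi> \<and> real (length \<pi>) \<le> f n"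
    if *: "length X = n \<and> distinct X \<and> A \<subseteq> set X \<and> B \<subseteq> set X \<and>
       is_parity A S \<sigma>a \<and> is_parity B T \<sigma>b \<and>
       is_parity (sym_diff A B) U (sym_diff_list X A B) \<and> z \<in> sym_diff A B \<and>
       set S \<inter> set T = {} \<and> set S \<inter> set U = {} \<and> set T \<inter> set U = {} \<and>
       set S \<inter> set X = {} \<and> set T \<inter> set X = {} \<and> set U \<inter> set X = {}"
    for n X A B \<sigma>a \<sigma>b S T U z
  proof -
    have AB: "A = set \<sigma>a" "B = set \<sigma>b" and "length \<sigma>a \<ge> 4"
      using * unfolding is_parity_def by blast+
    then have n: "n > 0" using * by (cases X) auto
    then obtain d where d: "2 ^ d \<le> n" "n < 2 ^ (d + 1)"
      using ex_power_ivl1 [of 2 n] by auto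
    obtain \<pi> where \<pi>: "ER_refutation (rAddPar X \<sigma>a S \<sigma>b T U z) \<pi>"
      "length \<pi> \<le> 520 * ((d + 1 + 1) * (3 * n) + 2 ^ (d + 1 + 1))"
      using rAddPar_refutation [of X \<sigma>a \<sigma>b S T "sym_diff A B" U z "d + 1"] * d(2) unfolding AB by auto
    have "2 ^ d \<le> real n" using d(1) by (metis of_nat_le_iff of_nat_numeral of_nat_power)
    then have "real d \<le> log 2 (real n)"
      using n by (simp add: le_log_iff powr_realpow)
    then have **: "(real d + 2) * (3 * real n) \<le> (log 2 (real n) + 2) * (3 * real n)"
      by (intro mult_right_mono) auto
    have "real (length \<pi>) \<le> 520 * ((real d + 2) * (3 * real n) + 4 * 2 ^ d)"
    proof -
      have "real (length \<pi>) \<le> real (520 * ((d + 1 + 1) * (3 * n) + 2 ^ (d + 1 + 1)))"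
        using \<pi>(2) by (rule of_nat_mono)
      then show ?thesis by (simp add: algebra_simps)
    qed
    moreover have "520 * ((real d + 2) * (3 * real n) + 4 * 2 ^ d) \<le> f n"
      unfolding f_def using ** \<open>2 ^ d \<le> real n\<close> by (intro mult_left_mono add_mono) auto
    ultimately have "real (length \<pi>) \<le> f n" by linarith
    with \<pi>(1) show "\<exists>\<pi>. ER_refutation (rAddPar X \<sigma>a S \<sigma>b T U z) \<pi> \<and> real (length \<pi>) \<le> f n"
      by blast
  qed
  show ?thesis
    by (intro exI [of _ f] conjI allI impI) (fact big, rule refutation)
qed

end
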